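(* Let $\mathcal R\subset\mathbb R^J$ be non-empty and finite and let $\delta\ge 0$. The column-and-constraint generation algorithm for min-max regret described in the context terminates in a finite number of steps with a feasible solution $\iota^\star\in\mathcal C^K$ to the offline min-max regret elicitation problem $$(\mathrm{QP}_r)\qquad\min_{\iota\in\mathcal C^K}\ \max_{s\in\mathcal S_\Gamma(\iota)}\ \min_{x\in\mathcal R}\ \max_{u\in\mathcal U_\Gamma(\iota,s)}\Big\{\max_{x'\in\mathcal R}u^\top x'-u^\top x\Big\}.$$ The objective value attained by this solution is within $\delta$ of the optimal objective value of $(\mathrm{QP}_r)$.
   Context: Data: integers $I\ge 2$, $J,K\ge 1$; items $x^1,\dots,x^I\in\mathbb R^J$; a recommendation set $\mathcal R\subset\mathbb R^J$; $\mathcal U^0=\{u\in\mathbb R^J:Bu\ge b\}$ with $B\in\mathbb R^{N\times J}$, $b\in\mathbb R^N$, non-empty, full-dimensional and bounded; $\Gamma\ge 0$. Notation: $\mathcal K=\{1,\dots,K\}$; $\mathcal C=\{(i,i'):1\le i<i'\le I\}$; $\iota=(\iota^\kappa)_{\kappa}\in\mathcal C^K$, $\iota^\kappa=(\iota_1^\kappa,\iota_2^\kappa)$; $d^\kappa=x^{\iota_1^\kappa}-x^{\iota_2^\kappa}$; $\mathcal E_\Gamma=\{\epsilon\in\mathbb R_+^K:\sum_\kappa\epsilon_\kappa\le\Gamma\}$; $\mathbf 1$ the all-ones vector. For $s\in\{-1,0,1\}^K$, $$\mathcal U_\Gamma(\iota,s)=\Big\{u\in\mathcal U^0:\exists\epsilon\in\mathcal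 E_\Gamma\text{ with }u^\top d^\kappa>-\epsilon_\kappa\ \forall\kappa:s_\kappa=1;\ |u^\top d^\kappa|\le\epsilon_\kappa\ \forall\kappa:s_\kappa=0;\ u^\top d^\kappa<\epsilon_\kappa\ \forall\kappa:s_\kappa=-1\Big\},$$ and $\mathcal S_\Gamma(\iota)=\{s\in\{-1,0,1\}^K:\mathcal U_\Gamma(\iota,s)\neq\emptyset\}$. $\max,\min$ denote suprema/infima. Relaxed main problem $\mathrm{Main}_r(\mathcal S')$, for $\mathcal S'\subseteq\{-1,1\}^K$: minimize $\tau$ over $\tau\in\mathbb R$, $\iota\in\mathcal C^K$, $x^s\in\mathcal R$ ($s\in\{-1,1\}^K$) and, for $s\in\mathcal S'$, $x'\in\mathcal R$, $\alpha^{(x',s)}\in\mathbb R_-^K$, $\beta^{(x',s)}\in\mathbb R_-^N$, $\mu^{(x',s)}\in\mathbb R_+$, subject to, for all $s\in\mathcal S'$, $x'\in\mathcal R$: $\tau\ge b^\top\beta^{(x',s)}+\Gamma\mu^{(x',s)}$; $\sum_\kappa s_\kappa d^\kappa\alpha_\kappa^{(x',s)}+B^\top\beta^{(x',s)}=x'-x^s$; $\alpha^{(x',s)}+\mu^{(x',s)}\mathbf 1\ge 0$. Feasibility problem $\mathrm{Feas}_r(\iota)$: maximize $\theta$ over $\theta\in\mathbb R$, $s\in\{-1,1\}^K$ and, for each $x\in\mathcal R$, $x'^{,x}\in\mathcal R$, $u^x\in\mathcal U^0$, $\epsilon^x\in\mathcal E_\Gamma$, subject to $\theta\le(u^x)^\top(x'^{,x}-x)$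 for all $x\in\mathcal R$ and, for all $\kappa\in\mathcal K$, $x\in\mathcal R$: $(u^x)^\top d^\kappa+\epsilon^x_\kappa\ge M(s_\kappa-1)$ and $(u^x)^\top d^\kappa-\epsilon^x_\kappa\le M(s_\kappa+1)$, where $M$ is a sufficiently large constant (large enough that the constraint with right-hand side $\mp2M$ is implied by $u^x\in\mathcal U^0$ and $\epsilon^x\in\mathcal E_\Gamma$). Algorithm. Input: tolerance $\delta$, $\mathcal C$, $\mathcal R$, $\mathcal U^0$, $K$. Initialize $\mathrm{UB}=+\infty$, $\mathrm{LB}=-\infty$, $\mathcal S'=\emptyset$. While $\mathrm{UB}-\mathrm{LB}>\delta$: (1) solve $\mathrm{Main}_r(\mathcal S')$; if solvable, let $(\tau,\iota,\dots)$ be an optimal solution; if unbounded, set $\tau=-\infty$ and let $\iota\in\mathcal C^K$ be such that $\mathrm{Main}_r(\mathcal S')$ is unbounded when the queries are fixed to $\iota$; set $\mathrm{LB}\leftarrow\tau$; (2) solve $\mathrm{Feas}_r(\iota)$, let $(\theta,\{u^x,x'^{,x},\epsilon^x\}_{x\in\mathcal R},s)$ be an optimal solution and set $\mathrm{UB}\leftarrow\theta$; (3) if $\theta>\tau$, set $\mathcal S'\leftarrow\mathcal S'\cup\{s\}$. Upon exit from the loop return $\iota^\star=\iota$ (with objective value $\theta$). *)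

theory Defs
  imports "HOL-Analysis.Analysis"
begin

text \<open>
  The dimensions \<open>J\<close>, \<open>N\<close> (number of rows of \<open>B\<close>) and \<open>K\<close> (number of queries) are the
  cardinalities of the index types \<open>'j\<close>, \<open>'n\<close> and \<open>'k\<close>. The items are \<open>item P 1, \<dots>, item P I\<close>
  with \<open>I = num_items P\<close>; other values of \<open>item P\<close> are irrelevant.
\<close>

record ('j::finite, 'n::finite) elicitation =
  num_items :: nat
  item :: "nat \<Rightarrow> real^'j"
  recs :: "(real^'j) set"
  Bmat :: "real^'j^'n"
  bvec :: "real^'n"
  Gam :: real

definition U0 :: "('j::finite, 'n::finite) elicitation \<Rightarrow> (real^'j) set" where
  "U0 P = {u. \<forall>i. (Bmat P *v u) $ i \<ge> bvec P $ i}"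

definition comparisons :: "('j::finite, 'n::finite) elicitation \<Rightarrow> (nat \<times> nat) set" where
  "comparisons P = {(i, i'). 1 \<le> i \<and> i < i' \<and> i' \<le> num_items P}"

definition queries :: "('j::finite, 'n::finite) elicitation \<Rightarrow> ((nat \<times> nat)^'k::finite) set" where
  "queries P = {q. \<forall>k. q $ k \<in> comparisons P}"

definition qdiff :: "('j::finite, 'n::finite) elicitation \<Rightarrow> (nat \<times> nat)^'k::finite \<Rightarrow> 'k \<Rightarrow> real^'j" where
  "qdiff P q k = item P (fst (q $ k)) - item P (snd (q $ k))"

definition Eps :: "('j::finite, 'n::finite) elicitation \<Rightarrow> (real^'k::finite) set" where
  "Eps P = {e. (\<forall>k. e $ k \<ge> 0) \<and> (\<Sum>k\<in>UNIV. e $ k) \<le> Gam P}"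

definition responses3 :: "(real^'k::finite) set" where
  "responses3 = {s. \<forall>k. s $ k \<in> {-1, 0, 1}}"

definition responses2 :: "(real^'k::finite) set" where
  "responses2 = {s. \<forall>k. s $ k \<in> {-1, 1}}"

definition Uset ::
  "('j::finite, 'n::finite) elicitation \<Rightarrow> (nat \<times> nat)^'k::finite \<Rightarrow> real^'k \<Rightarrow> (real^'j) set" where
  "Uset P q s = {u \<in> U0 P. \<exists>e \<in> Eps P.
     (\<forall>k. s $ k = 1 \<longrightarrow> u \<bullet> qdiff P q k > - (e $ k)) \<and>
     (\<forall>k. s $ k = 0 \<longrightarrow> \<bar>u \<bullet> qdiff P q k\<bar> \<le> e $ k) \<and>
     (\<forall>k. s $ k = -1 \<longrightarrow> u \<bullet> qdiff P q k < e $ k)}"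

definition Sset ::
  "('j::finite, 'n::finite) elicitation \<Rightarrow> (nat \<times> nat)^'k::finite \<Rightarrow> (real^'k) set" where
  "Sset P q = {s \<in> responses3. Uset P q s \<noteq> {}}"

subsection \<open>The offline min-max regret problem\<close>

text \<open>Maxima and minima are suprema and infima in the extended reals.\<close>

definition regret_objective ::
  "('j::finite, 'n::finite) elicitation \<Rightarrow> (nat \<times> nat)^'k::finite \<Rightarrow> ereal" where
  "regret_objective P q =
     (SUP s \<in> Sset P q. INF x \<in> recs P. SUP u \<in> Uset P q s.
        (SUP x' \<in> recs P. ereal (u \<bullet> x')) - ereal (u \<bullet> x))"

definition regret_optimum ::
  "('j::finite, 'n::finite) elicitation \<Rightarrow> 'k::finite itself \<Rightarrow> ereal" where
  "regret_optimum P _ = (INF q \<in> (queries P :: ((nat \<times> nat)^'k) set). regret_objective P q)"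

subsection \<open>The relaxed main problem\<close>

text \<open>
  Families of decision variables indexed by \<open>s\<close> or by \<open>x', s\<close> are total functions, constrained
  only on the index set that the problem uses.
\<close>

type_synonym ('j, 'n, 'k) main_sol =
  "real \<times> ((nat \<times> nat)^'k) \<times> (real^'k \<Rightarrow> real^'j) \<times> (real^'j \<Rightarrow> real^'k \<Rightarrow> real^'k) \<times>
   (real^'j \<Rightarrow> real^'k \<Rightarrow> real^'n) \<times> (real^'j \<Rightarrow> real^'k \<Rightarrow> real)"

definition main_feasible ::
  "('j::finite, 'n::finite) elicitation \<Rightarrow> (real^'k::finite) set \<Rightarrow> ('j, 'n, 'k) main_sol set" where
  "main_feasible P S' = {(\<tau>, q, y, \<alpha>, \<beta>, \<mu>).
     q \<in> queries P \<and> (\<forall>s \<in> responses2. y s \<in> recs P) \<and>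
     (\<forall>s \<in> S'. \<forall>x' \<in> recs P.
        (\<forall>k. \<alpha> x' s $ k \<le> 0) \<and> (\<forall>i. \<beta> x' s $ i \<le> 0) \<and> \<mu> x' s \<ge> 0 \<and>
        \<tau> \<ge> bvec P \<bullet> \<beta> x' s + Gam P * \<mu> x' s \<and>
        (\<Sum>k\<in>UNIV. (s $ k * \<alpha> x' s $ k) *\<^sub>R qdiff P q k) + transpose (Bmat P) *v \<beta> x' s = x' - y s \<and>
        (\<forall>k. \<alpha> x' s $ k + \<mu> x' s \<ge> 0))}"

definition main_optimal ::
  "('j::finite, 'n::finite) elicitation \<Rightarrow> (real^'k::finite) set \<Rightarrow> ('j, 'n, 'k) main_sol \<Rightarrow> bool" where
  "main_optimal P S' z \<longleftrightarrow>
     z \<in> main_feasible P S' \<and> (\<forall>z' \<in> main_feasible P S'. fst z \<le> fst z')"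

definition main_unbounded ::
  "('j::finite, 'n::finite) elicitation \<Rightarrow> (real^'k::finite) set \<Rightarrow> bool" where
  "main_unbounded P S' \<longleftrightarrow> (\<forall>r. \<exists>z \<in> main_feasible P S'. fst z < r)"

definition main_unbounded_at ::
  "('j::finite, 'n::finite) elicitation \<Rightarrow> (real^'k::finite) set \<Rightarrow> (nat \<times> nat)^'k \<Rightarrow> bool" where
  "main_unbounded_at P S' q \<longleftrightarrow>
     (\<forall>r. \<exists>z \<in> main_feasible P S'. fst (snd z) = q \<and> fst z < r)"

inductive main_result ::
  "('j::finite, 'n::finite) elicitation \<Rightarrow> (real^'k::finite) set \<Rightarrow> ereal \<Rightarrow> (nat \<times> nat)^'k \<Rightarrow> bool"
  for P S' where
  solvable: "main_optimal P S' (\<tau>, q, y, \<alpha>, \<beta>, \<mu>) \<Longrightarrow> main_result P S' (ereal \<tau>) q"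
| unbounded: "main_unbounded P S' \<Longrightarrow> main_unbounded_at P S' q \<Longrightarrow> main_result P S' (- \<infinity>) q"

subsection \<open>The feasibility problem\<close>

text \<open>The decision variables are \<open>\<theta>\<close>, \<open>s\<close> and the families \<open>x'\<close>, \<open>u\<close>, \<open>\<epsilon>\<close> indexed by \<open>x \<in> recs P\<close>.\<close>

type_synonym ('j, 'k) feas_sol =
  "real \<times> (real^'k) \<times> (real^'j \<Rightarrow> real^'j) \<times> (real^'j \<Rightarrow> real^'j) \<times> (real^'j \<Rightarrow> real^'k)"

definition big_M :: "('j::finite, 'n::finite) elicitation \<Rightarrow> 'k::finite itself \<Rightarrow> real \<Rightarrow> bool" where
  "big_M P _ M \<longleftrightarrow>
     (\<forall>q \<in> queries P. \<forall>u \<in> U0 P. \<forall>e \<in> Eps P. \<forall>k::'k.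
        u \<bullet> qdiff P q k + e $ k \<ge> - 2 * M \<and> u \<bullet> qdiff P q k - e $ k \<le> 2 * M)"

definition feas_feasible ::
  "('j::finite, 'n::finite) elicitation \<Rightarrow> real \<Rightarrow> (nat \<times> nat)^'k::finite \<Rightarrow> ('j, 'k) feas_sol set" where
  "feas_feasible P M q = {(\<theta>, s, x', u, \<epsilon>).
     s \<in> responses2 \<and>
     (\<forall>x \<in> recs P. x' x \<in> recs P \<and> u x \<in> U0 P \<and> \<epsilon> x \<in> Eps P \<and>
        \<theta> \<le> u x \<bullet> (x' x - x) \<and>
        (\<forall>k. u x \<bullet> qdiff P q k + \<epsilon> x $ k \<ge> M * (s $ k - 1) \<and>
             u x \<bullet> qdiff P q k - \<epsilon> x $ k \<le> M * (s $ k + 1)))}"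

definition feas_optimal ::
  "('j::finite, 'n::finite) elicitation \<Rightarrow> real \<Rightarrow> (nat \<times> nat)^'k::finite \<Rightarrow> ('j, 'k) feas_sol \<Rightarrow> bool" where
  "feas_optimal P M q z \<longleftrightarrow>
     z \<in> feas_feasible P M q \<and> (\<forall>z' \<in> feas_feasible P M q. fst z' \<le> fst z)"

subsection \<open>The column-and-constraint generation algorithm\<close>

text \<open>
  The algorithm is nondeterministic (any optimal solution may be selected), so one pass through
  the loop is a relation between states. The current queries are \<open>None\<close> before the first pass.
\<close>

record 'k algo_state =
  UB :: ereal
  LB :: ereal
  resp :: "(real^'k::finite) set"
  query :: "((nat \<times> nat)^'k::finite) option"

definition algo_init :: "'k::finite algo_state" where
  "algo_init = \<lparr>UB = \<infinity>, LB = - \<infinity>, resp = {}, query = None\<rparr>"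

definition loop_cond :: "real \<Rightarrow> 'k::finite algo_state \<Rightarrow> bool" where
  "loop_cond \<delta> st \<longleftrightarrow> UB st - LB st > ereal \<delta>"

inductive algo_step ::
  "('j::finite, 'n::finite) elicitation \<Rightarrow> real \<Rightarrow> real \<Rightarrow> 'k::finite algo_state \<Rightarrow> 'k algo_state \<Rightarrow> bool"
  for P M \<delta> where
  "loop_cond \<delta> st \<Longrightarrow>
   main_result P (resp st) \<tau> q \<Longrightarrow>
   feas_optimal P M q (\<theta>, s, x', u, \<epsilon>) \<Longrightarrow>
   algo_step P M \<delta> st
     \<lparr>UB = ereal \<theta>, LB = \<tau>,
      resp = (if ereal \<theta> > \<tau> then resp st \<union> {s} else resp st),
      query = Some q\<rparr>"

definition reachable ::
  "('j::finite, 'n::finite) elicitation \<Rightarrow> real \<Rightarrow> real \<Rightarrow> 'k::finite algo_state \<Rightarrow> bool" where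
  "reachable P M \<delta> st \<longleftrightarrow> (algo_step P M \<delta>)\<^sup>*\<^sup>* algo_init st"

text \<open>
  Every execution is finite, and none gets stuck: both subproblems can be solved as the
  algorithm prescribes whenever the loop is entered.
\<close>

definition algo_terminates ::
  "('j::finite, 'n::finite) elicitation \<Rightarrow> real \<Rightarrow> real \<Rightarrow> 'k::finite itself \<Rightarrow> bool" where
  "algo_terminates P M \<delta> _ \<longleftrightarrow>
     \<not> (\<exists>run :: nat \<Rightarrow> 'k algo_state. run 0 = algo_init \<and> (\<forall>t. algo_step P M \<delta> (run t) (run (Suc t)))) \<and>
     (\<forall>st :: 'k algo_state. reachable P M \<delta> st \<and> loop_cond \<delta> st \<longrightarrow>
        (\<exists>\<tau> q. main_result P (resp st) \<tau> q) \<and>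
        (\<forall>\<tau> q. main_result P (resp st) \<tau> q \<longrightarrow> (\<exists>z. feas_optimal P M q z)))"

end

theory Submission
  imports Defs
begin

text \<open>For responses \<open>s\<close> in \<open>{-1, 1}\<close> replace the strict inequalities by weak ones; the resulting
  sets of utilities are compact polytopes, and both subproblems optimise the regret over them. Linear
  programming duality shows that the relaxed main problem for \<open>S'\<close> minimises over the queries the largest
  regret among the responses in \<open>S'\<close> that are possible for the query, and the feasibility problem
  computes the regret of a query over all possible responses. If the latter exceeds the lower
  bound, the response found is not yet in \<open>S'\<close>; there are only finitely many responses, so the
  loop ends. Passing to weak inequalities does not change the min-max regret: a response whose
  weakened set is not the closure of the original one is covered by one with some indifferent
  answers.\<close>

subsection \<open>Linear programming duality\<close>

text \<open>The convex cone hull of finitely many vectors is closed, so a point \<open>f\<close>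
  outside it is strictly separated from it by a hyperplane. The normal \<open>z\<close> is
  nonnegative on every generator because the cone is closed under scaling, and this contradicts the
  hypothesis at \<open>f\<close>.\<close>

lemma farkas:
  fixes a :: "'i::finite \<Rightarrow> 'v::euclidean_space"
  assumes "\<And>z. (\<And>i. z \<bullet> a i \<ge> 0) \<Longrightarrow> z \<bullet> f \<ge> 0"
  shows "\<exists>l. (\<forall>i. l i \<ge> (0::real)) \<and> f = (\<Sum>i\<in>UNIV. l i *\<^sub>R a i)"
proof -
  define C where "C = convex_cone hull (range a)"
  define D where "D = {(\<Sum>i\<in>UNIV. l i *\<^sub>R a i) | l. \<forall>i. l i \<ge> (0::real)}"
  have "range a \<subseteq> D"
  proof clarify
    fix i
    have "a i = (\<Sum>j\<in>UNIV. (if j = i then 1 else 0) *\<^sub>R a j)"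
      by (simp add: if_distrib[of "\<lambda>c. c *\<^sub>R _"] sum.delta cong: if_cong)
    then show "a i \<in> D"
      unfolding D_def by (intro CollectI exI[of _ "\<lambda>j. if j = i then 1 else 0"]) simp
  qed
  moreover have "convex_cone D"
    unfolding convex_cone_iff
  proof (intro conjI ballI allI impI)
    show "0 \<in> D" unfolding D_def by (auto intro!: exI[of _ "\<lambda>_. 0"])
  next
    fix x y assume "x \<in> D" "y \<in> D"
    then obtain l m where "\<forall>i. l i \<ge> 0" "\<forall>i. m i \<ge> 0"
      "x = (\<Sum>i\<in>UNIV. l i *\<^sub>R a i)" "y = (\<Sum>i\<in>UNIV. m i *\<^sub>R a i)"
      unfolding D_def by blast
    then show "x + y \<in> D"
      unfolding D_def
      by (intro CollectI exI[of _ "\<lambda>i. l i + m i"]) (simp add: scaleR_left_distrib sum.distrib)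
  next
    fix x and c :: real assume "x \<in> D" "c \<ge> 0"
    then obtain l where "\<forall>i. l i \<ge> 0" "x = (\<Sum>i\<in>UNIV. l i *\<^sub>R a i)"
      unfolding D_def by blast
    then show "c *\<^sub>R x \<in> D"
      unfolding D_def using \<open>c \<ge> 0\<close>
      by (intro CollectI exI[of _ "\<lambda>i. c * l i"]) (simp add: scaleR_sum_right)
  qed
  ultimately have "C \<subseteq> D"
    unfolding C_def by (rule hull_minimal)
  moreover have "f \<in> C"
  proof (rule ccontr)
    assume "f \<notin> C"
    moreover have "closed C" "convex C"
      unfolding C_def by (auto intro: closed_convex_cone_hull convex_convex_cone_hull)
    ultimately obtain z b where zb: "z \<bullet> f < b" "\<And>x. x \<in> C \<Longrightarrow> z \<bullet> x > b"
      using separating_hyperplane_closed_point[of C f] by blast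
    have "0 \<in> C" unfolding C_def by (rule convex_cone_hull_contains_0)
    then have "b < 0" using zb(2)[of 0] by simp
    have "z \<bullet> a i \<ge> 0" for i
    proof (rule ccontr)
      assume neg: "\<not> z \<bullet> a i \<ge> 0"
      \<comment> \<open>The scaling factor is chosen such that \<open>t *\<^sub>R a i\<close> lies
        exactly on the separating hyperplane, where the strict inequality fails.\<close>
      define t where "t = b / (z \<bullet> a i)"
      have "t \<ge> 0" using neg \<open>b < 0\<close> unfolding t_def by (simp add: divide_nonpos_neg)
      moreover have "a i \<in> C" unfolding C_def by (simp add: hull_inc)
      ultimately have "t *\<^sub>R a i \<in> C"
        unfolding C_def by (intro convex_cone_hull_mul)
      from zb(2)[OF this] show False using neg by (simp add: t_def)
    qed
    with assms[of z] zb(1) \<open>b < 0\<close> show False by simp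
  qed
  ultimately show ?thesis unfolding D_def by blast
qed

text \<open>Multiplying by \<open>s $ k\<close> merges the two weak inequalities: it reads
  \<open>u \<bullet> d \<ge> - e\<close> for the answer 1 and \<open>u \<bullet> d \<le> e\<close>
  for the answer -1.\<close>

definition closed_Uset ::
  "('j::finite, 'n::finite) elicitation \<Rightarrow> (nat \<times> nat)^'k::finite \<Rightarrow> real^'k \<Rightarrow> (real^'j) set" where
  "closed_Uset P q s = {u \<in> U0 P. \<exists>e \<in> Eps P. \<forall>k. s $ k * (u \<bullet> qdiff P q k) + e $ k \<ge> 0}"

text \<open>Such a \<open>z\<close> is a direction of recession: moving from a point of
  \<open>U0 P\<close> along it never leaves the set.\<close>

lemma bounded_U0_recession:
  assumes "U0 P \<noteq> {}" "bounded (U0 P)" "\<And>i. (Bmat P *v z) $ i \<ge> 0"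
  shows "z = 0"
proof (rule ccontr)
  assume "z \<noteq> 0"
  obtain u where u: "u \<in> U0 P" using assms(1) by blast
  obtain C where C: "\<And>x. x \<in> U0 P \<Longrightarrow> norm x \<le> C"
    using assms(2) unfolding bounded_iff by blast
  \<comment> \<open>The step has length \<open>C + norm u + 1\<close>, one more than the triangle
    inequality permits within the bound \<open>C\<close>.\<close>
  define t where "t = (C + norm u + 1) / norm z"
  have "norm u \<le> C" by (rule C[OF u])
  then have C0: "C \<ge> 0" using norm_ge_zero[of u] by linarith
  then have "t \<ge> 0" unfolding t_def by simp
  then have "u + t *\<^sub>R z \<in> U0 P"
    using u assms(3) unfolding U0_def
    by (auto simp: matrix_vector_right_distrib matrix_vector_mult_scaleR intro: add_increasing2)
  from C[OF this] have "norm (t *\<^sub>R z) \<le> C + norm u"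
    using norm_triangle_ineq2[of "t *\<^sub>R z" "- u"] by (simp add: add.commute)
  moreover have "norm (t *\<^sub>R z) = C + norm u + 1"
    using \<open>z \<noteq> 0\<close> \<open>t \<ge> 0\<close> by (simp add: t_def) (use C0 norm_ge_zero[of u] in linarith)
  ultimately show False by simp
qed

lemma inner_vec_matrix:
  fixes B :: "real^'j^'n"
  shows "u \<bullet> (transpose B *v b) = (B *v u) \<bullet> b"
  by (metis dot_lmul_matrix inner_commute transpose_matrix_vector)

text \<open>Since \<open>U0 P\<close> is nonempty and bounded, the homogeneous system only has solutions with
  \<open>u = 0\<close>. Therefore an empty \<open>closed_Uset P q s\<close> is not an exception here: the dual is then
  feasible for every \<open>v\<close>.\<close>

lemma dual_exists:
  fixes P :: "('j::finite, 'n::finite) elicitation" and q :: "(nat \<times> nat)^'k::finite"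
  assumes "U0 P \<noteq> {}" "bounded (U0 P)"
    and le: "\<And>u. u \<in> closed_Uset P q s \<Longrightarrow> u \<bullet> c \<le> v"
  shows "\<exists>(\<alpha>::real^'k) \<beta> \<mu>. (\<forall>k. \<alpha> $ k \<le> 0) \<and> (\<forall>i. \<beta> $ i \<le> 0) \<and> \<mu> \<ge> 0 \<and>
    v \<ge> bvec P \<bullet> \<beta> + Gam P * \<mu> \<and>
    (\<Sum>k\<in>UNIV. (s $ k * \<alpha> $ k) *\<^sub>R qdiff P q k) + transpose (Bmat P) *v \<beta> = c \<and>
    (\<forall>k. \<alpha> $ k + \<mu> \<ge> 0)"
proof -
  \<comment> \<open>One generator for each inequality of the homogenised primal system in
    \<open>((u, e), t)\<close>: the rows of \<open>B\<close>, the answers, \<open>e \<ge> 0\<close>,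
    the budget, and \<open>t \<ge> 0\<close>. Pairing with \<open>((- c, 0), v)\<close> then
    expresses the claim \<open>u \<bullet> c \<le> t * v\<close>.\<close>
  define a :: "'n + 'k + 'k + bool \<Rightarrow> ((real^'j) \<times> (real^'k)) \<times> real" where
    "a = case_sum (\<lambda>i. ((Bmat P $ i, 0), - bvec P $ i))
      (case_sum (\<lambda>k. ((s $ k *\<^sub>R qdiff P q k, axis k 1), 0))
        (case_sum (\<lambda>k. ((0, axis k 1), 0))
          (\<lambda>t. if t then ((0, - 1), Gam P) else (0, 1))))"
  have "\<exists>l. (\<forall>i. l i \<ge> (0::real)) \<and> ((- c, 0), v) = (\<Sum>i\<in>UNIV. l i *\<^sub>R a i)"
  proof (rule farkas)
    fix z :: "((real^'j) \<times> (real^'k)) \<times> real"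
    obtain u e t where z: "z = ((u, e), t)" by (metis surj_pair)
    assume "\<And>i. z \<bullet> a i \<ge> 0"
    note h = this[of "Inl _"] this[of "Inr (Inl _)"] this[of "Inr (Inr (Inl _))"]
      this[of "Inr (Inr (Inr True))"] this[of "Inr (Inr (Inr False))"]
    have B: "(Bmat P *v u) $ i \<ge> t * bvec P $ i" for i
      using h(1)[of i] by (simp add: a_def z matrix_vector_mul_component inner_commute)
    have S: "s $ k * (u \<bullet> qdiff P q k) + e $ k \<ge> 0" for k
      using h(2)[of k] by (simp add: a_def z inner_axis)
    have E: "e $ k \<ge> 0" for k
      using h(3)[of k] by (simp add: a_def z inner_axis)
    have G: "(\<Sum>k\<in>UNIV. e $ k) \<le> t * Gam P"
      using h(4) by (simp add: a_def z inner_vec_def sum_negf)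
    have t: "t \<ge> 0"
      using h(5) by (simp add: a_def z)
    show "z \<bullet> ((- c, 0), v) \<ge> 0"
    proof (cases "t = 0")
      case True
      then have "u = 0" using bounded_U0_recession[OF assms(1,2)] B by simp
      then show ?thesis using True by (simp add: z)
    next
      case False
      with t have t: "t > 0" by simp
      have "u /\<^sub>R t \<in> U0 P"
        using B t by (simp add: U0_def matrix_vector_mult_scaleR field_simps)
      moreover have "e /\<^sub>R t \<in> Eps P"
        using E G t by (simp add: Eps_def field_simps flip: sum_distrib_left sum_divide_distrib)
      moreover have "s $ k * ((u /\<^sub>R t) \<bullet> qdiff P q k) + (e /\<^sub>R t) $ k \<ge> 0" for k
      proof -
        have "s $ k * ((u /\<^sub>R t) \<bullet> qdiff P q k) + (e /\<^sub>R t) $ k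
            = (s $ k * (u \<bullet> qdiff P q k) + e $ k) / t"
          using t by (simp add: field_simps)
        then show ?thesis using S[of k] t by simp
      qed
      ultimately have "u /\<^sub>R t \<in> closed_Uset P q s"
        unfolding closed_Uset_def by blast
      from le[OF this] show ?thesis
        using t by (simp add: z field_simps)
    qed
  qed
  then obtain l where l0: "\<And>i. l i \<ge> (0::real)"
    and l: "((- c, 0), v) = (\<Sum>i\<in>UNIV. l i *\<^sub>R a i)" by blast
  \<comment> \<open>The Farkas multipliers give the dual solution \<beta> = \<open>- l1\<close>,
    \<alpha> = \<open>- l2\<close>, \<mu> = \<open>l4\<close>. The vector \<open>l3\<close> is the
    slack in \<alpha> + \<mu> \<ge> 0, and \<open>l5\<close> is the slack in the bound by
    \<open>v\<close>.\<close>
  define l1 where "l1 = (\<chi> i. l (Inl i))"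
  define l2 where "l2 = (\<chi> k. l (Inr (Inl k)))"
  define l3 where "l3 = (\<chi> k. l (Inr (Inr (Inl k))))"
  define l4 where "l4 = l (Inr (Inr (Inr True)))"
  define l5 where "l5 = l (Inr (Inr (Inr False)))"
  note l_defs = l1_def l2_def l3_def l4_def l5_def
  have "((- c, 0 :: real^'k), v) = (\<Sum>i\<in>UNIV. l1 $ i *\<^sub>R ((Bmat P $ i, 0), - bvec P $ i)) +
      ((\<Sum>k\<in>UNIV. l2 $ k *\<^sub>R ((s $ k *\<^sub>R qdiff P q k, axis k 1), 0)) +
       ((\<Sum>k\<in>UNIV. l3 $ k *\<^sub>R ((0, axis k 1), 0)) +
         (l4 *\<^sub>R ((0, - 1), Gam P) + l5 *\<^sub>R (0, 1))))"
    unfolding l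
    by (simp only: UNIV_Plus_UNIV[symmetric] sum.Plus[OF finite finite])
      (simp add: a_def l_defs o_def UNIV_bool add.commute)
  then have c: "- c = (\<Sum>i\<in>UNIV. l1 $ i *\<^sub>R (Bmat P $ i)) + (\<Sum>k\<in>UNIV. (l2 $ k * s $ k) *\<^sub>R qdiff P q k)"
    and e: "0 = (\<Sum>k\<in>UNIV. l2 $ k *\<^sub>R axis k 1) + (\<Sum>k\<in>UNIV. l3 $ k *\<^sub>R axis k 1) - l4 *\<^sub>R (1::real^'k)"
    and v: "v = - (\<Sum>i\<in>UNIV. l1 $ i * bvec P $ i) + l4 * Gam P + l5"
    by (auto simp: prod_eq_iff fst_sum snd_sum sum_negf algebra_simps)
  have ek: "l2 $ k + l3 $ k = l4" for k
    using arg_cong[OF e, of "\<lambda>w. w $ k"]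
    by (simp add: axis_def if_distrib[of "\<lambda>c. _ * c"] cong: if_cong)
  have "transpose (Bmat P) *v (- l1) = - (\<Sum>i\<in>UNIV. l1 $ i *\<^sub>R (Bmat P $ i))"
    by (simp add: vec_eq_iff matrix_vector_mult_def transpose_def sum_negf mult.commute)
  moreover have "(\<Sum>k\<in>UNIV. (s $ k * (- l2) $ k) *\<^sub>R qdiff P q k)
      = - (\<Sum>k\<in>UNIV. (l2 $ k * s $ k) *\<^sub>R qdiff P q k)"
    by (simp add: sum_negf mult.commute)
  ultimately have eq: "(\<Sum>k\<in>UNIV. (s $ k * (- l2) $ k) *\<^sub>R qdiff P q k) + transpose (Bmat P) *v (- l1) = c"
    using c by (metis (no_types, lifting) add.commute minus_add_distrib minus_minus)
  have "bvec P \<bullet> (- l1) + Gam P * l4 \<le> v"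
    using v l0[of "Inr (Inr (Inr False))"] by (simp add: inner_vec_def l5_def mult.commute sum_negf)
  moreover have "(- l2) $ k + l4 \<ge> 0" for k
    using ek[of k] l0[of "Inr (Inr (Inl k))"] by (simp add: l3_def)
  moreover have "(- l2) $ k \<le> 0" "(- l1) $ i \<le> 0" "l4 \<ge> 0" for i k
    using l0 by (simp_all add: l_defs)
  ultimately show ?thesis using eq by blast
qed

text \<open>Pair the dual equation with \<open>u\<close>. The answers and \<alpha> \<le> 0, then
  \<alpha> + \<mu> \<ge> 0 and the budget, bound the first summand by \<Gamma>\<mu>; the
  inequalities defining \<open>U0 P\<close> and \<beta> \<le> 0 bound the second.\<close>

lemma weak_duality:
  fixes P :: "('j::finite, 'n::finite) elicitation" and q :: "(nat \<times> nat)^'k::finite"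
  assumes "\<And>k. \<alpha> $ k \<le> 0" "\<And>i. \<beta> $ i \<le> 0" "\<mu> \<ge> 0"
    and v: "v \<ge> bvec P \<bullet> \<beta> + Gam P * \<mu>"
    and eq: "(\<Sum>k\<in>UNIV. (s $ k * \<alpha> $ k) *\<^sub>R qdiff P q k) + transpose (Bmat P) *v \<beta> = c"
    and am: "\<And>k. \<alpha> $ k + \<mu> \<ge> 0"
    and u: "u \<in> closed_Uset P q s"
  shows "u \<bullet> c \<le> v"
proof -
  obtain e where e: "e \<in> Eps P" "\<And>k. s $ k * (u \<bullet> qdiff P q k) + e $ k \<ge> 0" and U: "u \<in> U0 P"
    using u unfolding closed_Uset_def by blast
  have "u \<bullet> (\<Sum>k\<in>UNIV. (s $ k * \<alpha> $ k) *\<^sub>R qdiff P q k) = (\<Sum>k\<in>UNIV. \<alpha> $ k * (s $ k * (u \<bullet> qdiff P q k)))"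
    by (simp add: inner_sum_right mult_ac)
  also have "\<dots> \<le> (\<Sum>k\<in>UNIV. \<alpha> $ k * - e $ k)"
    using e(2) assms(1) by (intro sum_mono mult_left_mono_neg) (auto simp: minus_le_iff add.commute real_0_le_add_iff)
  also have "\<dots> \<le> (\<Sum>k\<in>UNIV. \<mu> * e $ k)"
  proof (rule sum_mono)
    fix k
    have "e $ k \<ge> 0" using e(1) by (simp add: Eps_def)
    with am[of k] have "(\<alpha> $ k + \<mu>) * e $ k \<ge> 0" by simp
    then show "\<alpha> $ k * - e $ k \<le> \<mu> * e $ k" by (simp add: algebra_simps)
  qed
  also have "\<dots> = \<mu> * (\<Sum>k\<in>UNIV. e $ k)" by (simp add: sum_distrib_left)
  also have "\<dots> \<le> \<mu> * Gam P"
    using e(1) assms(3) by (intro mult_left_mono) (auto simp: Eps_def)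
  finally have 1: "u \<bullet> (\<Sum>k\<in>UNIV. (s $ k * \<alpha> $ k) *\<^sub>R qdiff P q k) \<le> \<mu> * Gam P" .
  have "(Bmat P *v u) \<bullet> \<beta> \<le> bvec P \<bullet> \<beta>"
    unfolding inner_vec_def using U assms(2)
    by (intro sum_mono) (auto simp: U0_def intro: mult_right_mono_neg)
  then have "u \<bullet> (transpose (Bmat P) *v \<beta>) \<le> bvec P \<bullet> \<beta>"
    by (simp only: inner_vec_matrix)
  with 1 v show ?thesis
    by (simp add: eq[symmetric] inner_add_right mult.commute)
qed

subsection \<open>Regret of a query over closed response sets\<close>

lemma finite_responses2: "finite (responses2 :: (real^'k::finite) set)"
proof (rule finite_subset)
  show "responses2 \<subseteq> vec_lambda ` (PiE UNIV (\<lambda>_::'k. {-1, 1 :: real}))"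
  proof
    fix s :: "real^'k" assume "s \<in> responses2"
    then have "(\<lambda>k. s $ k) \<in> PiE UNIV (\<lambda>_. {-1, 1})" by (auto simp: responses2_def)
    then show "s \<in> vec_lambda ` (PiE UNIV (\<lambda>_::'k. {-1, 1 :: real}))"
      by (metis image_eqI vec_nth_inverse)
  qed
qed (intro finite_imageI finite_PiE; simp)

lemma finite_queries: "finite (queries P :: ((nat \<times> nat)^'k::finite) set)"
proof (rule finite_subset)
  have "comparisons P \<subseteq> {..num_items P} \<times> {..num_items P}" by (auto simp: comparisons_def)
  then have fin: "finite (comparisons P)" by (rule finite_subset) simp
  show "finite (vec_lambda ` (PiE UNIV (\<lambda>_::'k. comparisons P)))"
    by (intro finite_imageI finite_PiE) (simp_all add: fin)
  show "queries P \<subseteq> vec_lambda ` (PiE UNIV (\<lambda>_::'k. comparisons P))"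
  proof
    fix q :: "(nat \<times> nat)^'k" assume "q \<in> queries P"
    then have "(\<lambda>k. q $ k) \<in> PiE UNIV (\<lambda>_. comparisons P)" by (auto simp: queries_def)
    then show "q \<in> vec_lambda ` (PiE UNIV (\<lambda>_. comparisons P))"
      by (metis image_eqI vec_nth_inverse)
  qed
qed

lemma queries_nonempty:
  assumes "num_items P \<ge> 2"
  shows "(queries P :: ((nat \<times> nat)^'k::finite) set) \<noteq> {}"
proof -
  have "(\<chi> k::'k. (1, 2)) \<in> queries P" using assms by (simp add: queries_def comparisons_def)
  then show ?thesis by blast
qed

section \<open>Compactness and convexity of the constraint sets\<close>

lemma closed_U0: "closed (U0 P)"
  unfolding U0_def
  by (intro closed_Collect_all closed_Collect_le continuous_intros
        linear_continuous_on matrix_vector_mul_bounded_linear)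

lemma convex_U0: "convex (U0 P)"
proof (rule convexI)
  fix x y and a b :: real assume *: "x \<in> U0 P" "y \<in> U0 P" "a \<ge> 0" "b \<ge> 0" "a + b = 1"
  have "bvec P $ i \<le> a * (Bmat P *v x) $ i + b * (Bmat P *v y) $ i" for i
  proof -
    have "bvec P $ i = a * bvec P $ i + b * bvec P $ i"
      using *(5) by (simp flip: distrib_right)
    also have "\<dots> \<le> a * (Bmat P *v x) $ i + b * (Bmat P *v y) $ i"
      using * by (intro add_mono mult_left_mono) (auto simp: U0_def)
    finally show ?thesis .
  qed
  then show "a *\<^sub>R x + b *\<^sub>R y \<in> U0 P"
    by (simp add: U0_def matrix_vector_right_distrib matrix_vector_mult_scaleR)
qed

lemma compact_Eps: "compact (Eps P :: (real^'k::finite) set)"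
proof -
  have "closed (Eps P :: (real^'k) set)"
    unfolding Eps_def
    by (intro closed_Collect_conj closed_Collect_all closed_Collect_le continuous_intros)
  moreover have "bounded (Eps P :: (real^'k) set)"
  proof (rule boundedI)
    fix e :: "real^'k" assume e: "e \<in> Eps P"
    have "norm e \<le> (\<Sum>k\<in>UNIV. \<bar>e $ k\<bar>)" by (rule norm_le_l1_cart)
    also have "\<dots> \<le> Gam P" using e by (simp add: Eps_def)
    finally show "norm e \<le> Gam P" .
  qed
  ultimately show ?thesis by (simp add: compact_eq_bounded_closed)
qed

lemma convex_Eps: "convex (Eps P :: (real^'k::finite) set)"
proof (rule convexI)
  fix x y :: "real^'k" and a b :: real
  assume *: "x \<in> Eps P" "y \<in> Eps P" "a \<ge> 0" "b \<ge> 0" "a + b = 1"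
  have "a * (\<Sum>k\<in>UNIV. x $ k) + b * (\<Sum>k\<in>UNIV. y $ k) \<le> a * Gam P + b * Gam P"
    using * by (intro add_mono mult_left_mono) (auto simp: Eps_def)
  also have "\<dots> = Gam P" using *(5) by (simp flip: distrib_right)
  finally show "a *\<^sub>R x + b *\<^sub>R y \<in> Eps P"
    using * by (simp add: Eps_def sum.distrib sum_distrib_left)
qed

text \<open>Keeping the error vector as a coordinate leaves a set cut out by linear inequalities;
  the utilities alone are its projection.\<close>

definition response_pairs ::
  "('j::finite, 'n::finite) elicitation \<Rightarrow> (nat \<times> nat)^'k::finite \<Rightarrow> real^'k \<Rightarrow> ((real^'j) \<times> (real^'k)) set" where
  "response_pairs P q s =
     {(u, e) \<in> U0 P \<times> Eps P. \<forall>k. s $ k * (u \<bullet> qdiff P q k) + e $ k \<ge> 0}"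

lemma closed_Uset_eq: "closed_Uset P q s = fst ` response_pairs P q s"
  unfolding closed_Uset_def response_pairs_def by force

lemma compact_closed_Uset:
  fixes P :: "('j::finite, 'n::finite) elicitation" and q :: "(nat \<times> nat)^'k::finite"
  assumes "bounded (U0 P)"
  shows "compact (closed_Uset P q s)"
proof -
  have "compact (U0 P \<times> (Eps P :: (real^'k) set))"
    using assms closed_U0 compact_Eps by (intro compact_Times) (auto simp: compact_eq_bounded_closed)
  moreover have "closed {z :: (real^'j) \<times> (real^'k). \<forall>k. s $ k * (fst z \<bullet> qdiff P q k) + snd z $ k \<ge> 0}"
    by (intro closed_Collect_all closed_Collect_le continuous_intros)
  moreover have "response_pairs P q s = (U0 P \<times> Eps P) \<inter>
      {z. \<forall>k. s $ k * (fst z \<bullet> qdiff P q k) + snd z $ k \<ge> 0}"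
    unfolding response_pairs_def by auto
  ultimately have "compact (response_pairs P q s)"
    by (simp add: compact_Int_closed)
  then show ?thesis
    unfolding closed_Uset_eq by (intro compact_continuous_image continuous_intros)
qed

section \<open>Regret values of responses and queries\<close>

definition relevant ::
  "('j::finite, 'n::finite) elicitation \<Rightarrow> (nat \<times> nat)^'k::finite \<Rightarrow> (real^'k) set" where
  "relevant P q = {s \<in> responses2. closed_Uset P q s \<noteq> {}}"

text \<open>The maximum over \<open>x'\<close> is taken outside the supremum over \<open>u\<close>,
  so that each supremum is that of a single linear function. The value is meaningful when
  \<open>closed_Uset P q s\<close> is nonempty, as it is for
  \<open>s \<in> relevant P q\<close>.\<close>

definition resp_regret ::
  "('j::finite, 'n::finite) elicitation \<Rightarrow> (nat \<times> nat)^'k::finite \<Rightarrow> real^'k \<Rightarrow> real" where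
  "resp_regret P q s = Min ((\<lambda>x. Max ((\<lambda>x'. SUP u \<in> closed_Uset P q s. u \<bullet> (x' - x)) ` recs P)) ` recs P)"

definition query_regret ::
  "('j::finite, 'n::finite) elicitation \<Rightarrow> (nat \<times> nat)^'k::finite \<Rightarrow> real" where
  "query_regret P q = Max (resp_regret P q ` relevant P q)"

lemma finite_relevant: "finite (relevant P q)"
  unfolding relevant_def by (simp add: finite_responses2)

text \<open>Any utility in \<open>U0 P\<close> is consistent, with zero error, with the signs of its
  own comparisons. Hence the maximum in \<open>query_regret\<close> ranges over a nonempty
  set.\<close>

lemma relevant_nonempty:
  fixes q :: "(nat \<times> nat)^'k::finite"
  assumes "U0 P \<noteq> {}" "Gam P \<ge> 0"
  shows "relevant P q \<noteq> {}"
proof -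
  obtain u where u: "u \<in> U0 P" using assms by blast
  define s :: "real^'k" where "s = (\<chi> k. if u \<bullet> qdiff P q k \<ge> 0 then 1 else - 1)"
  have "u \<in> closed_Uset P q s"
    unfolding closed_Uset_def using u assms(2)
    by (auto intro!: exI[of _ 0] simp: s_def Eps_def)
  moreover have "s \<in> responses2" by (simp add: responses2_def s_def)
  ultimately show ?thesis unfolding relevant_def by blast
qed

lemma max_linear_closed_Uset:
  assumes "bounded (U0 P)" "closed_Uset P q s \<noteq> {}"
  obtains u where "u \<in> closed_Uset P q s" "(SUP w \<in> closed_Uset P q s. w \<bullet> c) = u \<bullet> c"
    "\<And>w. w \<in> closed_Uset P q s \<Longrightarrow> w \<bullet> c \<le> u \<bullet> c"
proof -
  have "continuous_on (closed_Uset P q s) (\<lambda>w. w \<bullet> c)" by (intro continuous_intros)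
  from continuous_attains_sup[OF compact_closed_Uset[OF assms(1)] assms(2) this]
  obtain u where u: "u \<in> closed_Uset P q s" "\<And>w. w \<in> closed_Uset P q s \<Longrightarrow> w \<bullet> c \<le> u \<bullet> c" by blast
  then have "(SUP w \<in> closed_Uset P q s. w \<bullet> c) = u \<bullet> c"
    by (intro cSup_eq_maximum) auto
  with u that show ?thesis by blast
qed

text \<open>The right-hand side is the form used by the main problem: one recommendation is good
  against all \<open>x'\<close> and \<open>u\<close>.\<close>

lemma resp_regret_le_iff:
  assumes "bounded (U0 P)" "finite (recs P)" "recs P \<noteq> {}" "closed_Uset P q s \<noteq> {}"
  shows "resp_regret P q s \<le> v \<longleftrightarrow>
    (\<exists>x\<in>recs P. \<forall>x'\<in>recs P. \<forall>u\<in>closed_Uset P q s. u \<bullet> (x' - x) \<le> v)"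
proof -
  have "(SUP u \<in> closed_Uset P q s. u \<bullet> c) \<le> v \<longleftrightarrow> (\<forall>u\<in>closed_Uset P q s. u \<bullet> c \<le> v)" for c
    by (rule max_linear_closed_Uset[OF assms(1,4), of c]) force
  then show ?thesis
    unfolding resp_regret_def using assms by (simp add: Min_le_iff)
qed

text \<open>The form used by the feasibility problem: since the supremum over the compact set is
  attained, a lower bound is witnessed by a utility for each recommendation.\<close>

lemma le_resp_regret_iff:
  assumes "bounded (U0 P)" "finite (recs P)" "recs P \<noteq> {}" "closed_Uset P q s \<noteq> {}"
  shows "v \<le> resp_regret P q s \<longleftrightarrow>
    (\<forall>x\<in>recs P. \<exists>x'\<in>recs P. \<exists>u\<in>closed_Uset P q s. v \<le> u \<bullet> (x' - x))"
proof -
  have "v \<le> (SUP u \<in> closed_Uset P q s. u \<bullet> c) \<longleftrightarrow> (\<exists>u\<in>closed_Uset P q s. v \<le> u \<bullet> c)" for c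
    by (rule max_linear_closed_Uset[OF assms(1,4), of c]) force
  then show ?thesis
    unfolding resp_regret_def using assms by (simp add: Max_ge_iff)
qed

subsection \<open>The two subproblems\<close>

lemma main_feasible_imp_bound:
  assumes "bounded (U0 P)" "finite (recs P)" "recs P \<noteq> {}"
    and "S' \<subseteq> responses2" "(\<tau>, q, y, \<alpha>, \<beta>, \<mu>) \<in> main_feasible P S'" "s \<in> S' \<inter> relevant P q"
  shows "resp_regret P q s \<le> \<tau>"
proof -
  have s: "s \<in> S'" "s \<in> responses2" "closed_Uset P q s \<noteq> {}"
    using assms(6) by (auto simp: relevant_def)
  \<comment> \<open>The dual variables for \<open>x'\<close> and \<open>s\<close> certify \<tau> as
    a bound on the regret of the recommendation \<open>y s\<close>.\<close>
  have "u \<bullet> (x' - y s) \<le> \<tau>" if "x' \<in> recs P" "u \<in> closed_Uset P q s" for x' u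
    using assms(5) s that
    by (intro weak_duality[of "\<alpha> x' s" "\<beta> x' s" "\<mu> x' s"]) (auto simp: main_feasible_def)
  moreover have "y s \<in> recs P" using assms(5) s by (auto simp: main_feasible_def)
  ultimately show ?thesis
    by (subst resp_regret_le_iff[OF assms(1-3) s(3)]) blast
qed

text \<open>For a relevant \<open>s\<close> in \<open>S'\<close>, let \<open>y s\<close> attain the
  minimum in the regret; duality supplies the multipliers for each \<open>x'\<close>. For an
  irrelevant \<open>s\<close> in \<open>S'\<close> the closed set is empty, so every recommendation
  has multipliers for every \<tau>.\<close>

lemma bound_imp_main_feasible:
  fixes q :: "(nat \<times> nat)^'k::finite"
  assumes "U0 P \<noteq> {}" "bounded (U0 P)" "finite (recs P)" "recs P \<noteq> {}"
    and "q \<in> queries P" "S' \<subseteq> responses2" "\<And>s. s \<in> S' \<inter> relevant P q \<Longrightarrow> resp_regret P q s \<le> \<tau>"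
  shows "\<exists>y \<alpha> \<beta> \<mu>. (\<tau>, q, y, \<alpha>, \<beta>, \<mu>) \<in> main_feasible P S'"
proof -
  have "\<exists>x\<in>recs P. s \<in> S' \<longrightarrow> (\<forall>x'\<in>recs P. \<forall>u\<in>closed_Uset P q s. u \<bullet> (x' - x) \<le> \<tau>)" for s
  proof (cases "s \<in> S' \<inter> relevant P q")
    case True
    then have "closed_Uset P q s \<noteq> {}" by (simp add: relevant_def)
    from resp_regret_le_iff[OF assms(2-4) this] assms(7)[OF True] show ?thesis by blast
  next
    case False
    then have "closed_Uset P q s = {}" if "s \<in> S'" using that assms(6) by (auto simp: relevant_def)
    then show ?thesis using assms(4) by blast
  qed
  then obtain y where y: "\<And>s. y s \<in> recs P"
    "\<And>s x' u. s \<in> S' \<Longrightarrow> x' \<in> recs P \<Longrightarrow> u \<in> closed_Uset P q s \<Longrightarrow> u \<bullet> (x' - y s) \<le> \<tau>"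
    by metis
  define D where "D s x' = (\<lambda>(\<alpha> :: real^'k, \<beta>, \<mu>). (\<forall>k. \<alpha> $ k \<le> 0) \<and> (\<forall>i. \<beta> $ i \<le> 0) \<and> \<mu> \<ge> 0 \<and>
    \<tau> \<ge> bvec P \<bullet> \<beta> + Gam P * \<mu> \<and>
    (\<Sum>k\<in>UNIV. (s $ k * \<alpha> $ k) *\<^sub>R qdiff P q k) + transpose (Bmat P) *v \<beta> = x' - y s \<and>
    (\<forall>k. \<alpha> $ k + \<mu> \<ge> 0))" for s x'
  have "\<exists>z. s \<in> S' \<longrightarrow> x' \<in> recs P \<longrightarrow> D s x' z" for s x'
    using dual_exists[OF assms(1,2), of q s "x' - y s" \<tau>] y(2)[of s x'] unfolding D_def by auto
  then have "\<forall>s x'. \<exists>z. s \<in> S' \<longrightarrow> x' \<in> recs P \<longrightarrow> D s x' z" by blast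
  then obtain z where z: "\<forall>s x'. s \<in> S' \<longrightarrow> x' \<in> recs P \<longrightarrow> D s x' (z s x')"
    unfolding choice_iff by blast
  then have "(\<tau>, q, y, \<lambda>x' s. fst (z s x'), \<lambda>x' s. fst (snd (z s x')), \<lambda>x' s. snd (snd (z s x')))
      \<in> main_feasible P S'"
    using y(1) assms(5) by (auto simp: main_feasible_def D_def case_prod_beta)
  then show ?thesis by blast
qed

text \<open>The regret of any query is a feasible value of \<tau>, which gives the lower bound in
  the solvable case. In the unbounded case no relevant response of \<open>q\<close> lies in
  \<open>S'\<close>, since its regret would bound \<tau> from below.\<close>

lemma main_result_bounds:
  fixes q :: "(nat \<times> nat)^'k::finite"
  assumes "U0 P \<noteq> {}" "bounded (U0 P)" "Gam P \<ge> 0" "finite (recs P)" "recs P \<noteq> {}"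
    and "S' \<subseteq> responses2" "main_result P S' \<tau> q"
  shows "q \<in> queries P"
    and "\<And>s. s \<in> S' \<inter> relevant P q \<Longrightarrow> ereal (resp_regret P q s) \<le> \<tau>"
    and "\<And>q' :: (nat \<times> nat)^'k. q' \<in> queries P \<Longrightarrow> \<tau> \<le> ereal (query_regret P q')"
proof -
  have up: "\<exists>y \<alpha> \<beta> \<mu>. (query_regret P q', q', y, \<alpha>, \<beta>, \<mu>) \<in> main_feasible P S'"
    if "q' \<in> queries P" for q' :: "(nat \<times> nat)^'k"
    using assms that finite_relevant[of P q']
    by (intro bound_imp_main_feasible) (auto simp: query_regret_def)
  from assms(7) have "q \<in> queries P \<and> (\<forall>s \<in> S' \<inter> relevant P q. ereal (resp_regret P q s) \<le> \<tau>) \<and>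
     (\<forall>q' \<in> (queries P :: ((nat \<times> nat)^'k) set). \<tau> \<le> ereal (query_regret P q'))"
  proof cases
    case (solvable \<tau>' y \<alpha> \<beta> \<mu>)
    then have *: "(\<tau>', q, y, \<alpha>, \<beta>, \<mu>) \<in> main_feasible P S'"
      "\<And>z. z \<in> main_feasible P S' \<Longrightarrow> \<tau>' \<le> fst z" by (auto simp: main_optimal_def)
    have "\<tau>' \<le> query_regret P q'" if "q' \<in> queries P" for q' :: "(nat \<times> nat)^'k"
      using up[OF that] *(2) by fastforce
    moreover have "q \<in> queries P" using *(1) by (auto simp: main_feasible_def)
    ultimately show ?thesis
      using solvable main_feasible_imp_bound[OF assms(2,4,5,6) *(1)] by auto
  next
    case unbounded
    then have un: "\<exists>z \<in> main_feasible P S'. fst (snd z) = q \<and> fst z < r" for r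
      by (auto simp: main_unbounded_at_def)
    have "q \<in> queries P" using un[of 0] by (auto simp: main_feasible_def)
    moreover have "s \<notin> S' \<inter> relevant P q" for s
      using un[of "resp_regret P q s"] main_feasible_imp_bound[OF assms(2,4,5,6)]
      by (metis linorder_not_le prod.collapse)
    ultimately show ?thesis using unbounded by auto
  qed
  then show "q \<in> queries P"
    and "\<And>s. s \<in> S' \<inter> relevant P q \<Longrightarrow> ereal (resp_regret P q s) \<le> \<tau>"
    and "\<And>q' :: (nat \<times> nat)^'k. q' \<in> queries P \<Longrightarrow> \<tau> \<le> ereal (query_regret P q')" by auto
qed

text \<open>If some query has no relevant response in \<open>S'\<close>, as in the first pass where
  \<open>S'\<close> is empty, the problem is unbounded at that query. Otherwise it amounts to
  minimising a real function over the finitely many queries.\<close>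

lemma main_result_exists:
  fixes S' :: "(real^'k::finite) set"
  assumes "num_items P \<ge> 2" "U0 P \<noteq> {}" "bounded (U0 P)" "finite (recs P)" "recs P \<noteq> {}"
    and "S' \<subseteq> responses2"
  shows "\<exists>\<tau> q. main_result P S' \<tau> q"
proof (cases "\<exists>q \<in> queries P. S' \<inter> relevant P q = {}")
  case True
  then obtain q where q: "q \<in> queries P" "S' \<inter> relevant P q = {}" by blast
  have "\<exists>z \<in> main_feasible P S'. fst (snd z) = q \<and> fst z < r" for r
    using bound_imp_main_feasible[OF assms(2-5) q(1) assms(6), of "r - 1"] q(2)
    by fastforce
  then have "main_unbounded_at P S' q" "main_unbounded P S'"
    unfolding main_unbounded_at_def main_unbounded_def by blast+
  then show ?thesis by (meson main_result.unbounded)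
next
  case False
  define val where "val q = Max (resp_regret P q ` (S' \<inter> relevant P q))" for q
  have "\<exists>q \<in> queries P. \<forall>q' \<in> queries P. val q \<le> val q'"
    using Min_in[of "val ` queries P"] Min_le[of "val ` queries P"] finite_queries[where P = P and 'k = 'k]
      queries_nonempty[OF assms(1), where 'k = 'k]
    by fastforce
  then obtain q where q: "q \<in> queries P" "\<And>q'. q' \<in> queries P \<Longrightarrow> val q \<le> val q'" by blast
  obtain y \<alpha> \<beta> \<mu> where z: "(val q, q, y, \<alpha>, \<beta>, \<mu>) \<in> main_feasible P S'"
    using bound_imp_main_feasible[OF assms(2-5) q(1) assms(6), of "val q"] finite_relevant[of P q]
    by (auto simp: val_def)
  have "val q \<le> fst z'" if "z' \<in> main_feasible P S'" for z'
  proof -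
    obtain \<tau>' q' y' \<alpha>' \<beta>' \<mu>' where z': "z' = (\<tau>', q', y', \<alpha>', \<beta>', \<mu>')" by (metis surj_pair)
    have q': "q' \<in> queries P" using that by (simp add: z' main_feasible_def)
    have "val q' \<le> \<tau>'"
      using False q' main_feasible_imp_bound[OF assms(3-6)] that finite_relevant[of P q']
      by (auto simp: val_def z')
    with q(2)[OF q'] show ?thesis by (simp add: z')
  qed
  with z have "main_optimal P S' (val q, q, y, \<alpha>, \<beta>, \<mu>)" by (simp add: main_optimal_def)
  then show ?thesis by (meson main_result.solvable)
qed

section \<open>The feasibility problem\<close>

lemma big_M_constraints_iff:
  fixes q :: "(nat \<times> nat)^'k::finite"
  assumes "big_M P TYPE('k) M" "q \<in> queries P" "u \<in> U0 P" "e \<in> Eps P" "s \<in> responses2"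
  shows "(\<forall>k. u \<bullet> qdiff P q k + e $ k \<ge> M * (s $ k - 1) \<and> u \<bullet> qdiff P q k - e $ k \<le> M * (s $ k + 1))
    \<longleftrightarrow> (\<forall>k. s $ k * (u \<bullet> qdiff P q k) + e $ k \<ge> 0)"
proof (rule all_cong1)
  \<comment> \<open>For each answer one of the two constraints has right-hand side 0, and the other
    one is implied by the choice of \<open>M\<close>.\<close>
  fix k
  have "u \<bullet> qdiff P q k + e $ k \<ge> - 2 * M" "u \<bullet> qdiff P q k - e $ k \<le> 2 * M"
    using assms by (auto simp: big_M_def)
  moreover have "s $ k = 1 \<or> s $ k = -1" using assms(5) by (auto simp: responses2_def)
  ultimately show "(u \<bullet> qdiff P q k + e $ k \<ge> M * (s $ k - 1) \<and> u \<bullet> qdiff P q k - e $ k \<le> M * (s $ k + 1))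
    \<longleftrightarrow> s $ k * (u \<bullet> qdiff P q k) + e $ k \<ge> 0" by auto
qed

text \<open>Once \<theta> and \<open>s\<close> are fixed, the variables attached to different
  recommendations are independent, so the existence of the families reduces to existence for each
  \<open>x\<close> separately.\<close>

lemma feas_feasible_iff:
  fixes q :: "(nat \<times> nat)^'k::finite"
  assumes "bounded (U0 P)" "finite (recs P)" "recs P \<noteq> {}" "big_M P TYPE('k) M" "q \<in> queries P"
  shows "(\<exists>x' u \<epsilon>. (\<theta>, s, x', u, \<epsilon>) \<in> feas_feasible P M q) \<longleftrightarrow>
    s \<in> relevant P q \<and> \<theta> \<le> resp_regret P q s"
proof (cases "s \<in> responses2")
  case True
  have "(\<exists>x' u \<epsilon>. (\<theta>, s, x', u, \<epsilon>) \<in> feas_feasible P M q) \<longleftrightarrow>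
    (\<exists>x' u \<epsilon>. \<forall>x\<in>recs P. x' x \<in> recs P \<and> u x \<in> U0 P \<and> \<epsilon> x \<in> Eps P \<and> \<theta> \<le> u x \<bullet> (x' x - x) \<and>
      (\<forall>k. s $ k * (u x \<bullet> qdiff P q k) + \<epsilon> x $ k \<ge> 0))"
    using True big_M_constraints_iff[OF assms(4,5) _ _ True]
    unfolding feas_feasible_def by (simp cong: conj_cong)
  also have "\<dots> \<longleftrightarrow> (\<forall>x\<in>recs P. \<exists>x' u \<epsilon>. x' \<in> recs P \<and> u \<in> U0 P \<and> \<epsilon> \<in> Eps P \<and> \<theta> \<le> u \<bullet> (x' - x) \<and>
      (\<forall>k. s $ k * (u \<bullet> qdiff P q k) + \<epsilon> $ k \<ge> 0))"
    by (simp only: bchoice_iff)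
  also have "\<dots> \<longleftrightarrow> (\<forall>x\<in>recs P. \<exists>x'\<in>recs P. \<exists>u\<in>closed_Uset P q s. \<theta> \<le> u \<bullet> (x' - x))"
    unfolding closed_Uset_def by blast
  also have "\<dots> \<longleftrightarrow> closed_Uset P q s \<noteq> {} \<and> \<theta> \<le> resp_regret P q s"
    \<comment> \<open>If the closed set is empty, the left-hand side fails too, because there is at
      least one recommendation.\<close>
    using le_resp_regret_iff[OF assms(1-3), of q s \<theta>] assms(3)
    by (cases "closed_Uset P q s = {}") auto
  finally show ?thesis using True by (simp add: relevant_def)
qed (auto simp: feas_feasible_def relevant_def)

text \<open>An optimal solution not only has the regret of the query as its value, it also returns a
  response attaining it. This is what later shows that the response is new.\<close>

lemma feas_optimal_iff:
  fixes q :: "(nat \<times> nat)^'k::finite"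
  assumes "U0 P \<noteq> {}" "Gam P \<ge> 0"
    and "bounded (U0 P)" "finite (recs P)" "recs P \<noteq> {}" "big_M P TYPE('k) M" "q \<in> queries P"
  shows "(\<exists>x' u \<epsilon>. feas_optimal P M q (\<theta>, s, x', u, \<epsilon>)) \<longleftrightarrow>
    s \<in> relevant P q \<and> \<theta> = resp_regret P q s \<and> \<theta> = query_regret P q"
proof -
  note fin = finite_relevant[of P q]
  note ne = relevant_nonempty[OF assms(1,2), of q]
  note ff = feas_feasible_iff[OF assms(3-7)]
  have "(\<exists>x' u \<epsilon>. feas_optimal P M q (\<theta>, s, x', u, \<epsilon>)) \<longleftrightarrow>
     (\<exists>x' u \<epsilon>. (\<theta>, s, x', u, \<epsilon>) \<in> feas_feasible P M q) \<and>
     (\<forall>\<theta>' s'. (\<exists>x' u \<epsilon>. (\<theta>', s', x', u, \<epsilon>) \<in> feas_feasible P M q) \<longrightarrow> \<theta>' \<le> \<theta>)"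
    unfolding feas_optimal_def by fastforce
  also have "\<dots> \<longleftrightarrow> s \<in> relevant P q \<and> \<theta> \<le> resp_regret P q s \<and>
     (\<forall>s' \<in> relevant P q. resp_regret P q s' \<le> \<theta>)"
    unfolding ff by (meson order_refl order_trans)
  also have "\<dots> \<longleftrightarrow> s \<in> relevant P q \<and> \<theta> = resp_regret P q s \<and> \<theta> = query_regret P q"
  proof -
    have "\<theta> = query_regret P q"
      if "s \<in> relevant P q" "\<theta> = resp_regret P q s" "\<forall>s' \<in> relevant P q. resp_regret P q s' \<le> \<theta>"
      unfolding query_regret_def by (rule Max_eqI[symmetric]) (use that fin in auto)
    moreover have "\<forall>s' \<in> relevant P q. resp_regret P q s' \<le> query_regret P q"
      unfolding query_regret_def using fin by simp
    ultimately show ?thesis by (metis order_antisym order_refl)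
  qed
  finally show ?thesis .
qed

subsection \<open>From closed to original response sets\<close>

lemma convex_response_pairs: "convex (response_pairs P q s)"
proof (rule convexI)
  fix z w and a b :: real
  assume *: "z \<in> response_pairs P q s" "w \<in> response_pairs P q s" "a \<ge> 0" "b \<ge> 0" "a + b = 1"
  obtain u e u' e' where zw: "z = (u, e)" "w = (u', e')" by (metis surj_pair)
  have "s $ k * ((a *\<^sub>R u + b *\<^sub>R u') \<bullet> qdiff P q k) + (a *\<^sub>R e + b *\<^sub>R e') $ k
      = a * (s $ k * (u \<bullet> qdiff P q k) + e $ k) + b * (s $ k * (u' \<bullet> qdiff P q k) + e' $ k)" for k
    by (simp add: inner_add_left algebra_simps)
  moreover have "a * (s $ k * (u \<bullet> qdiff P q k) + e $ k) + b * (s $ k * (u' \<bullet> qdiff P q k) + e' $ k) \<ge> 0" for k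
    using * by (auto simp: zw response_pairs_def)
  ultimately show "a *\<^sub>R z + b *\<^sub>R w \<in> response_pairs P q s"
    using * convexD[OF convex_U0, of u P u' a b] convexD[OF convex_Eps, of e P e' a b]
    by (auto simp: zw response_pairs_def)
qed

text \<open>An indifferent answer bounds the comparison from both sides, so it satisfies the weak
  inequality for either sign; strict inequalities are merely weakened.\<close>

lemma Uset_subset_closed_Uset:
  assumes "s' \<in> responses2" "s \<in> responses3" "\<And>k. s $ k \<noteq> 0 \<Longrightarrow> s' $ k = s $ k"
  shows "Uset P q s \<subseteq> closed_Uset P q s'"
proof
  fix u assume "u \<in> Uset P q s"
  then obtain e where u: "u \<in> U0 P" "e \<in> Eps P"
    and e: "\<And>k. s $ k = 1 \<Longrightarrow> u \<bullet> qdiff P q k > - (e $ k)"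
      "\<And>k. s $ k = 0 \<Longrightarrow> \<bar>u \<bullet> qdiff P q k\<bar> \<le> e $ k"
      "\<And>k. s $ k = -1 \<Longrightarrow> u \<bullet> qdiff P q k < e $ k"
    unfolding Uset_def by blast
  have "s' $ k * (u \<bullet> qdiff P q k) + e $ k \<ge> 0" for k
  proof -
    consider "s $ k = 1" "s' $ k = 1" | "s $ k = -1" "s' $ k = -1" | "s $ k = 0" "s' $ k \<in> {-1, 1}"
      using assms(1,2) assms(3)[of k] by (auto simp: responses2_def responses3_def)
    then show ?thesis using e(1-3)[of k] by cases (auto simp: abs_le_iff)
  qed
  with u show "u \<in> closed_Uset P q s'" unfolding closed_Uset_def by blast
qed

text \<open>Take a point of the closed set at which the number of strict constraints is maximal. A
  constraint that is not strict there holds with equality throughout the closed set, so that the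
  response can be relaxed to indifference; open segments ending at this point lie in \<open>Uset\<close>.\<close>

lemma linear_bound_extends_to_closed_Uset:
  fixes q :: "(nat \<times> nat)^'k::finite"
  assumes "s \<in> relevant P q"
  obtains s' where "s' \<in> Sset P q"
    "\<And>c r u. (\<And>w. w \<in> Uset P q s' \<Longrightarrow> w \<bullet> c \<le> r) \<Longrightarrow> u \<in> closed_Uset P q s \<Longrightarrow> u \<bullet> c \<le> r"
proof -
  define g where "g = (\<lambda>(u, e) k. s $ k * (u \<bullet> qdiff P q k) + e $ k)"
  define strict where "strict z = {k. g z k > 0}" for z
  have nonneg: "g z k \<ge> 0" if "z \<in> response_pairs P q s" for z k
    using that by (auto simp: g_def response_pairs_def)
  have affine: "g ((1 - t) *\<^sub>R z + t *\<^sub>R w) k = (1 - t) * g z k + t * g w k" for t z w k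
    by (simp add: g_def case_prod_beta inner_add_left algebra_simps)
  obtain z1 where "z1 \<in> response_pairs P q s"
    using assms by (auto simp: relevant_def closed_Uset_eq)
  moreover have "\<forall>z. z \<in> response_pairs P q s \<longrightarrow> card (strict z) < Suc CARD('k)"
    by (simp add: card_mono le_imp_less_Suc)
  ultimately have "\<exists>z0. z0 \<in> response_pairs P q s \<and>
      (\<forall>z. z \<in> response_pairs P q s \<longrightarrow> card (strict z) \<le> card (strict z0))"
    by (rule Lattices_Big.ex_has_greatest_nat)
  then obtain z0 where z0: "z0 \<in> response_pairs P q s"
    and max: "\<And>z. z \<in> response_pairs P q s \<Longrightarrow> card (strict z) \<le> card (strict z0)"
    by blast
  have tight: "g z k = 0" if z: "z \<in> response_pairs P q s" and k: "k \<notin> strict z0" for z k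
  proof (rule ccontr)
    assume "g z k \<noteq> 0"
    then have "g z k > 0" using nonneg[OF z, of k] by simp
    \<comment> \<open>At the midpoint every constraint strict at \<open>z\<close> or at
      \<open>z0\<close> is strict, so it would have more strict constraints than
      \<open>z0\<close>.\<close>
    define m where "m = (1 - 1/2) *\<^sub>R z + (1/2 :: real) *\<^sub>R z0"
    have m: "m \<in> response_pairs P q s"
      unfolding m_def using convexD[OF convex_response_pairs z z0] by simp
    have "strict z0 \<subset> strict m"
      using k nonneg[OF z] nonneg[OF z0] \<open>g z k > 0\<close> unfolding strict_def m_def affine
      by (auto simp: add_nonneg_pos add_pos_nonneg intro!: psubsetI)
    then have "card (strict z0) < card (strict m)" by (simp add: psubset_card_mono)
    with max[OF m] show False by simp
  qed
  define s' :: "real^'k" where "s' = (\<chi> k. if k \<in> strict z0 then s $ k else 0)"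
  have s: "s $ k = 1 \<or> s $ k = -1" for k
    using assms by (auto simp: relevant_def responses2_def)
  \<comment> \<open>Positive weight on \<open>z0\<close> keeps its strict constraints strict. The
    other constraints hold with equality, so the comparison has absolute value \<open>e $ k\<close>,
    which is what indifference permits.\<close>
  have segment: "fst ((1 - t) *\<^sub>R z + t *\<^sub>R z0) \<in> Uset P q s'"
    if z: "z \<in> response_pairs P q s" and t: "0 < t" "t \<le> 1" for z t
  proof -
    obtain u e where m: "(1 - t) *\<^sub>R z + t *\<^sub>R z0 = (u, e)" by (metis surj_pair)
    have mem: "(u, e) \<in> response_pairs P q s"
      unfolding m[symmetric] using convexD[OF convex_response_pairs z z0] t by simp
    have mem': "u \<in> U0 P" "e \<in> Eps P" using mem by (auto simp: response_pairs_def)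
    have pos: "s $ k * (u \<bullet> qdiff P q k) + e $ k > 0" if "k \<in> strict z0" for k
    proof -
      have "g (u, e) k > 0"
        unfolding m[symmetric] affine using that t nonneg[OF z, of k]
        by (simp add: strict_def add_nonneg_pos)
      then show ?thesis by (simp add: g_def)
    qed
    have zero: "s $ k * (u \<bullet> qdiff P q k) + e $ k = 0" if "k \<notin> strict z0" for k
      using tight[OF mem that] by (simp add: g_def)
    have "(s' $ k = 1 \<longrightarrow> u \<bullet> qdiff P q k > - (e $ k)) \<and>
        (s' $ k = 0 \<longrightarrow> \<bar>u \<bullet> qdiff P q k\<bar> \<le> e $ k) \<and>
        (s' $ k = -1 \<longrightarrow> u \<bullet> qdiff P q k < e $ k)" for k
    proof (cases "k \<in> strict z0")
      case True
      then show ?thesis using pos[OF True] s[of k] by (auto simp: s'_def)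
    next
      case False
      have "e $ k \<ge> 0" using mem'(2) by (simp add: Eps_def)
      then show ?thesis using zero[OF False] s[of k] False by (auto simp: s'_def)
    qed
    with mem' have "u \<in> Uset P q s'" unfolding Uset_def by blast
    then show ?thesis by (simp add: m)
  qed
  have "s' \<in> responses3" using s by (auto simp: responses3_def s'_def)
  moreover have "Uset P q s' \<noteq> {}" using segment[OF z0, of 1] by auto
  ultimately have "s' \<in> Sset P q" by (simp add: Sset_def)
  moreover have "u \<bullet> c \<le> r"
    if bound: "\<And>w. w \<in> Uset P q s' \<Longrightarrow> w \<bullet> c \<le> r" and u: "u \<in> closed_Uset P q s" for c r u
  proof -
    obtain e where z: "(u, e) \<in> response_pairs P q s" using u by (auto simp: closed_Uset_eq)
    \<comment> \<open>The bound holds along the segment for small positive \<open>t\<close> and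
      passes to the limit at \<open>t = 0\<close>, where the point is \<open>u\<close>.\<close>
    define f where "f t = fst ((1 - t) *\<^sub>R (u, e) + t *\<^sub>R z0) \<bullet> c" for t
    have "(f \<longlongrightarrow> f 0) (at_right 0)"
      unfolding f_def by (intro tendsto_intros)
    moreover have "eventually (\<lambda>t. f t \<le> r) (at_right 0)"
      using eventually_at_right_less[of 0] eventually_at_right_real[of 0 1]
      by (rule eventually_elim2) (use bound segment[OF z] in \<open>auto simp: f_def\<close>)
    ultimately have "f 0 \<le> r"
      by (intro tendsto_upperbound) auto
    then show ?thesis by (simp add: f_def)
  qed
  ultimately show ?thesis using that by blast
qed

lemma regret_le_iff:
  "(SUP x' \<in> recs P. ereal (u \<bullet> x')) - ereal (u \<bullet> x) \<le> ereal r \<longleftrightarrow> (\<forall>x'\<in>recs P. u \<bullet> (x' - x) \<le> r)"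
  by (simp add: ereal_minus_le SUP_le_iff inner_diff_right algebra_simps)

text \<open>Upper bound: every response set lies in the closed set of a two-valued response. Lower
  bound: for a two-valued response of largest regret, some original response set admits exactly the
  linear bounds that carry over to the closed set.\<close>

lemma regret_objective_eq:
  fixes q :: "(nat \<times> nat)^'k::finite"
  assumes "U0 P \<noteq> {}" "bounded (U0 P)" "Gam P \<ge> 0" "finite (recs P)" "recs P \<noteq> {}"
  shows "regret_objective P q = ereal (query_regret P q)"
proof (rule antisym)
  note fin = finite_relevant[of P q]
  note ne = relevant_nonempty[OF assms(1,3), of q]
  show "regret_objective P q \<le> ereal (query_regret P q)"
    unfolding regret_objective_def
  proof (rule SUP_least)
    fix s assume "s \<in> Sset P q"
    then have s: "s \<in> responses3" "Uset P q s \<noteq> {}" by (auto simp: Sset_def)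
    \<comment> \<open>Replacing indifference by 1 is an arbitrary choice; -1 would serve equally
      well.\<close>
    define s' :: "real^'k" where "s' = (\<chi> k. if s $ k = 0 then 1 else s $ k)"
    have s': "s' \<in> responses2" using s(1) by (auto simp: responses2_def responses3_def s'_def)
    have sub: "Uset P q s \<subseteq> closed_Uset P q s'"
      by (rule Uset_subset_closed_Uset[OF s' s(1)]) (simp add: s'_def)
    then have rel: "s' \<in> relevant P q" using s s' by (auto simp: relevant_def)
    then have "closed_Uset P q s' \<noteq> {}" by (simp add: relevant_def)
    from resp_regret_le_iff[OF assms(2,4,5) this, of "resp_regret P q s'"]
    obtain x where x: "x \<in> recs P"
      "\<And>x' u. x' \<in> recs P \<Longrightarrow> u \<in> closed_Uset P q s' \<Longrightarrow> u \<bullet> (x' - x) \<le> resp_regret P q s'"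
      by blast
    have "(SUP u \<in> Uset P q s. (SUP x' \<in> recs P. ereal (u \<bullet> x')) - ereal (u \<bullet> x)) \<le> ereal (resp_regret P q s')"
      by (rule SUP_least) (use x(2) sub in \<open>auto simp: regret_le_iff\<close>)
    also have "\<dots> \<le> ereal (query_regret P q)"
      unfolding query_regret_def using fin rel by simp
    finally show "(INF x \<in> recs P. SUP u \<in> Uset P q s. (SUP x' \<in> recs P. ereal (u \<bullet> x')) - ereal (u \<bullet> x))
        \<le> ereal (query_regret P q)"
      using x(1) by (rule INF_lower2[rotated])
  qed
  have "query_regret P q \<in> resp_regret P q ` relevant P q"
    unfolding query_regret_def using fin ne by (intro Max_in) auto
  then obtain s where s: "s \<in> relevant P q" "query_regret P q = resp_regret P q s" by blast
  obtain s' where s': "s' \<in> Sset P q"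
    "\<And>c r u. (\<And>w. w \<in> Uset P q s' \<Longrightarrow> w \<bullet> c \<le> r) \<Longrightarrow> u \<in> closed_Uset P q s \<Longrightarrow> u \<bullet> c \<le> r"
    using linear_bound_extends_to_closed_Uset[OF s(1)] by blast
  have ne_s: "closed_Uset P q s \<noteq> {}" using s(1) by (simp add: relevant_def)
  have "ereal (query_regret P q) \<le>
      (INF x \<in> recs P. SUP u \<in> Uset P q s'. (SUP x' \<in> recs P. ereal (u \<bullet> x')) - ereal (u \<bullet> x))"
  \<comment> \<open>Comparing with real upper bounds \<open>r\<close> turns the extended real
    suprema into linear bounds on \<open>Uset P q s'\<close>, which extend to the closed
    set.\<close>
  proof (rule INF_greatest, rule ereal_le_real)
    fix x r assume x: "x \<in> recs P"
      and le: "(SUP u \<in> Uset P q s'. (SUP x' \<in> recs P. ereal (u \<bullet> x')) - ereal (u \<bullet> x)) \<le> ereal r"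
    have "\<forall>x'\<in>recs P. w \<bullet> (x' - x) \<le> r" if "w \<in> Uset P q s'" for w
      using order_trans[OF SUP_upper[OF that] le] by (simp only: regret_le_iff)
    then have "u \<bullet> (x' - x) \<le> r" if "u \<in> closed_Uset P q s" "x' \<in> recs P" for u x'
      using s'(2)[of "x' - x" r u] that by blast
    then show "ereal (query_regret P q) \<le> ereal r"
      using resp_regret_le_iff[OF assms(2,4,5) ne_s, of r] x by (auto simp: s(2))
  qed
  also have "\<dots> \<le> regret_objective P q"
    unfolding regret_objective_def using s'(1) by (rule SUP_upper)
  finally show "ereal (query_regret P q) \<le> regret_objective P q" .
qed

subsection \<open>The algorithm\<close>

text \<open>The response returned attains the regret \<theta> of the query. Were it already in
  \<open>resp st\<close>, the main problem would give \<theta> \<le> \<tau>; so \<theta> > \<tau>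
  forces the set to grow strictly.\<close>

lemma algo_step_facts:
  fixes st :: "'k::finite algo_state"
  assumes "U0 P \<noteq> {}" "bounded (U0 P)" "Gam P \<ge> 0" "finite (recs P)" "recs P \<noteq> {}"
    and "big_M P TYPE('k) M"
    and sub: "resp st \<subseteq> responses2" and step: "algo_step P M \<delta> st st'"
  obtains q where "query st' = Some q" "q \<in> queries P" "UB st' = ereal (query_regret P q)"
    "\<And>q' :: (nat \<times> nat)^'k. q' \<in> queries P \<Longrightarrow> LB st' \<le> ereal (query_regret P q')"
    "resp st' \<subseteq> responses2" "LB st' < UB st' \<Longrightarrow> resp st \<subset> resp st'"
  using step
proof cases
  case (1 \<tau> q \<theta> s x' u \<epsilon>)
  note bounds = main_result_bounds[OF assms(1-5) sub 1(3)]
  have s: "s \<in> relevant P q" "\<theta> = resp_regret P q s" "\<theta> = query_regret P q"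
    using feas_optimal_iff[OF assms(1,3,2,4,5,6) bounds(1), of \<theta> s] 1(4) by blast+
  have "s \<notin> resp st" if "\<tau> < ereal \<theta>"
    using bounds(2)[of s] s that by auto
  then show ?thesis
    using 1 bounds(1,3) s sub by (intro that[of q]) (auto simp: relevant_def)
qed

text \<open>The loop invariant. The initial state is a separate case because its infinite upper
  bound is not the regret of any query.\<close>

lemma reachable_facts:
  fixes st :: "'k::finite algo_state"
  assumes "U0 P \<noteq> {}" "bounded (U0 P)" "Gam P \<ge> 0" "finite (recs P)" "recs P \<noteq> {}"
    and "big_M P TYPE('k) M" "reachable P M \<delta> st"
  shows "resp st \<subseteq> responses2 \<and> (st = algo_init \<or>
    (\<exists>q \<in> queries P. query st = Some q \<and> UB st = ereal (query_regret P q) \<and>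
      (\<forall>q' \<in> (queries P :: ((nat \<times> nat)^'k) set). LB st \<le> ereal (query_regret P q'))))"
  using assms(7) unfolding reachable_def
proof (induction rule: rtranclp_induct)
  case base
  then show ?case by (simp add: algo_init_def)
next
  case (step st st')
  then have "resp st \<subseteq> responses2" by blast
  then show ?case
    by (rule algo_step_facts[OF assms(1-6) _ step(2)]) blast
qed

lemma no_infinite_run:
  fixes run :: "nat \<Rightarrow> 'k::finite algo_state"
  assumes "U0 P \<noteq> {}" "bounded (U0 P)" "Gam P \<ge> 0" "finite (recs P)" "recs P \<noteq> {}"
    and "big_M P TYPE('k) M" "\<delta> \<ge> 0"
    and init: "run 0 = algo_init" and step: "\<And>t. algo_step P M \<delta> (run t) (run (Suc t))"
  shows False
proof -
  have "reachable P M \<delta> (run t)" for t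
    unfolding reachable_def by (induction t) (use init step in \<open>auto intro: rtranclp.rtrancl_into_rtrancl\<close>)
  then have sub: "resp (run t) \<subseteq> responses2" for t
    using reachable_facts[OF assms(1-6)] by blast
  have grow: "resp (run t) \<subset> resp (run (Suc t))" for t
  proof -
    \<comment> \<open>The next pass enters the loop from this state, so its bounds are still more
      than \<delta> \<ge> 0 apart; hence the pass that produced it added a response.\<close>
    have "UB (run (Suc t)) - LB (run (Suc t)) > ereal \<delta>"
      using step[of "Suc t"] by cases (simp add: loop_cond_def)
    moreover obtain v where "UB (run (Suc t)) = ereal v"
      by (rule algo_step_facts[OF assms(1-6) sub step]) blast
    ultimately have less: "LB (run (Suc t)) < UB (run (Suc t))"
      using \<open>\<delta> \<ge> 0\<close> by (cases "LB (run (Suc t))") auto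
    show ?thesis
      by (rule algo_step_facts[OF assms(1-6) sub step]) (use less in blast)
  qed
  have "card (resp (run t)) \<ge> t" for t
  proof (induction t)
    case (Suc t)
    have "card (resp (run t)) < card (resp (run (Suc t)))"
      using grow[of t] sub[of "Suc t"] finite_responses2 by (meson finite_subset psubset_card_mono)
    with Suc show ?case by simp
  qed simp
  moreover have "card (resp (run t)) \<le> card (responses2 :: (real^'k) set)" for t
    using sub[of t] finite_responses2 by (rule card_mono[rotated])
  ultimately show False by (meson Suc_n_not_le_n le_trans)
qed

theorem mainTheorem6:
  fixes P :: "('j::finite, 'n::finite) elicitation" and M \<delta> :: real
  assumes "num_items P \<ge> 2"
    and "U0 P \<noteq> {}"
    and "aff_dim (U0 P) = int DIM(real^'j)"
    and "bounded (U0 P)"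
    and "Gam P \<ge> 0"
    and "finite (recs P)" and "recs P \<noteq> {}"
    and "big_M P TYPE('k::finite) M"
    and "\<delta> \<ge> 0"
  shows "algo_terminates P M \<delta> TYPE('k) \<and>
    (\<forall>st :: 'k algo_state. reachable P M \<delta> st \<and> \<not> loop_cond \<delta> st \<longrightarrow>
       (\<exists>q. query st = Some q \<and> q \<in> queries P \<and>
            regret_objective P q = UB st \<and>
            \<bar>regret_objective P q - regret_optimum P TYPE('k)\<bar> \<le> ereal \<delta>))"
proof -
  note setting = assms(2,4,5,6,7)
  have "algo_terminates P M \<delta> TYPE('k)"
    unfolding algo_terminates_def
  proof (intro conjI allI impI)
    show "\<nexists>run :: nat \<Rightarrow> 'k algo_state. run 0 = algo_init \<and> (\<forall>t. algo_step P M \<delta> (run t) (run (Suc t)))"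
      using no_infinite_run[OF setting assms(8,9)] by blast
  next
    fix st :: "'k algo_state" assume "reachable P M \<delta> st \<and> loop_cond \<delta> st"
    then have sub: "resp st \<subseteq> responses2" using reachable_facts[OF setting assms(8)] by blast
    then show "\<exists>\<tau> q. main_result P (resp st) \<tau> q"
      by (rule main_result_exists[OF assms(1,2,4,6,7)])
    fix \<tau> q assume "main_result P (resp st) \<tau> q"
    then have q: "q \<in> queries P" by (rule main_result_bounds(1)[OF setting sub])
    have "query_regret P q \<in> resp_regret P q ` relevant P q"
      unfolding query_regret_def using relevant_nonempty[OF assms(2,5), of q] finite_relevant[of P q]
      by (intro Max_in) auto
    then show "\<exists>z. feas_optimal P M q z"
      using feas_optimal_iff[OF assms(2,5,4,6,7,8) q] by blast
  qed
  moreover have "\<exists>q. query st = Some q \<and> q \<in> queries P \<and> regret_objective P q = UB st \<and>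
      \<bar>regret_objective P q - regret_optimum P TYPE('k)\<bar> \<le> ereal \<delta>"
    if *: "reachable P M \<delta> st \<and> \<not> loop_cond \<delta> st" for st :: "'k algo_state"
  proof -
    \<comment> \<open>The initial gap is infinite, so at least one pass is made and a query is
      available on exit.\<close>
    have "st \<noteq> algo_init" using * by (auto simp: algo_init_def loop_cond_def)
    with * obtain q where q: "q \<in> queries P" "query st = Some q" "UB st = ereal (query_regret P q)"
      and LB: "\<And>q' :: (nat \<times> nat)^'k. q' \<in> queries P \<Longrightarrow> LB st \<le> ereal (query_regret P q')"
      using reachable_facts[OF setting assms(8), of \<delta> st] by blast
    note obj = regret_objective_eq[OF setting]
    \<comment> \<open>The optimum lies between the two bounds, and the upper bound is the value of
      the returned query; the gap at exit therefore bounds the error.\<close>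
    have "LB st \<le> regret_optimum P TYPE('k)"
      unfolding regret_optimum_def obj using LB by (intro INF_greatest)
    moreover have "regret_optimum P TYPE('k) \<le> UB st"
      unfolding regret_optimum_def obj q(3) using q(1) by (rule INF_lower)
    moreover have "UB st - LB st \<le> ereal \<delta>" using * by (simp add: loop_cond_def not_less)
    ultimately have "\<bar>UB st - regret_optimum P TYPE('k)\<bar> \<le> ereal \<delta>"
      unfolding q(3) by (cases "LB st"; cases "regret_optimum P TYPE('k)") auto
    then show ?thesis using q obj[of q] by auto
  qed
  ultimately show ?thesis by blast
qed

end
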